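(* For each $k\in\mathbb{N}$ with $k\ge 2$, let $\mathcal{D}_k^D$ be the structure with domain $T_k^D\cup\mathcal{A}_k^D$, where $T_k^D=\{i\in\mathbb{N}\mid 0\le i\le k\}$ and $\mathcal{A}_k^D=\{k+1\}$, whose relations interpreting $T,A,S,D,N$ are respectively $T_k^D$ and $$A_k^D=\{(k+1,i)\mid i\in\mathbb{N},\ 0\le i\le k\},$$ $$S_k^D=\{(i+1,i,k+1)\mid i\in\mathbb{N},\ 0\le i\le k-1\}\cup\{(0,k,k+1)\},$$ $$D_k^D=\{(1,0),(1,k+1),(2,1),(2,k+1)\},\qquad N^D=\{1,2\}.$$ Then, for each such $k$, $\mathcal{D}_k^D$ is a model for the scheme $TAS_1$ and for the scheme $TAS_2$.
   Context: $\mathbb{N}$ includes $0$. The schemes are sets of axioms in first-order logic with equality, with unary predicates $T,N$, binary predicates $A,D$ and a ternary predicate $S$. A relation interprets a predicate in the obvious way: $A(y,x)$ holds iff $(y,x)$ is in the relation interpreting $A$, and $S(z,x,y)$ holds iff $(z,x,y)$ is in the relation interpreting $S$, etc. All quantifiers range over the domain. (The set $\mathcal{A}_k^D$, the set of antitheses, is listed as part of the structure in the paper but interprets no predicate of the schemes.) $N$ is a defined predicate: $N(z)$ abbreviates $\exists x\exists y[S(z,x,y)\land D(z,x)\land D(z,y)]$. In a model, the relation listed for $N$ must coincide with this defined predicate. $TAS_1$ consists of the axioms: E1: $\exists x[T(x)]$. E2: $\forall x[T(x)\to\exists!\,y[A(y,x)]]$. E3: $\forall x\forall y[A(y,x)\to\exists!\,z[S(z,x,y)]]$.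 R1: $\forall x\forall y[A(y,x)\to[T(x)\land\neg A(x,y)]]$. R2: $\forall x\forall y\forall z[S(z,x,y)\to[T(z)\land[A(x,y)\lor A(y,x)]\land\neg[S(x,z,y)\lor S(y,x,z)]]]$. $TAS_2$ consists of E1, E2, E3, R1, R2 together with: E4: $\exists x[N(x)]$. E5: $\forall x[N(x)\to\exists y[N(y)\land y\neq x]]$. *)

theory Defs
  imports Main
begin

type_synonym var = string

datatype fm =
    PT var
  | PN var
  | PA var var
  | PD var var
  | PS var var var
  | Eq var var
  | Neg fm
  | Conj fm fm
  | Disj fm fm
  | Imp fm fm
  | Iff fm fm
  | All var fm
  | Ex var fm

text \<open>Unique existence over \<open>y\<close> is written out as
  \<open>\<exists>w. \<forall>y. \<phi> \<longleftrightarrow> y = w\<close>; the auxiliary variable \<open>w\<close>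
  must be different from \<open>y\<close> and not free in \<open>\<phi>\<close>.\<close>

definition Ex1 :: "var \<Rightarrow> var \<Rightarrow> fm \<Rightarrow> fm" where
  "Ex1 w y \<phi> = Ex w (All y (Iff \<phi> (Eq y w)))"

record 'a struct =
  dom :: "'a set"
  T_rel :: "'a set"
  A_rel :: "('a \<times> 'a) set"
  S_rel :: "('a \<times> 'a \<times> 'a) set"
  D_rel :: "('a \<times> 'a) set"
  N_rel :: "'a set"

definition is_structure :: "'a struct \<Rightarrow> bool" where
  "is_structure M \<longleftrightarrow>
     dom M \<noteq> {} \<and> T_rel M \<subseteq> dom M \<and> N_rel M \<subseteq> dom M \<and>
     A_rel M \<subseteq> dom M \<times> dom M \<and> D_rel M \<subseteq> dom M \<times> dom M \<and>
     S_rel M \<subseteq> dom M \<times> dom M \<times> dom M"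

primrec sat :: "'a struct \<Rightarrow> (var \<Rightarrow> 'a) \<Rightarrow> fm \<Rightarrow> bool" where
  "sat M \<rho> (PT x) \<longleftrightarrow> \<rho> x \<in> T_rel M"
| "sat M \<rho> (PN x) \<longleftrightarrow> \<rho> x \<in> N_rel M"
| "sat M \<rho> (PA y x) \<longleftrightarrow> (\<rho> y, \<rho> x) \<in> A_rel M"
| "sat M \<rho> (PD z x) \<longleftrightarrow> (\<rho> z, \<rho> x) \<in> D_rel M"
| "sat M \<rho> (PS z x y) \<longleftrightarrow> (\<rho> z, \<rho> x, \<rho> y) \<in> S_rel M"
| "sat M \<rho> (Eq x y) \<longleftrightarrow> \<rho> x = \<rho> y"
| "sat M \<rho> (Neg \<phi>) \<longleftrightarrow> \<not> sat M \<rho> \<phi>"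
| "sat M \<rho> (Conj \<phi> \<psi>) \<longleftrightarrow> sat M \<rho> \<phi> \<and> sat M \<rho> \<psi>"
| "sat M \<rho> (Disj \<phi> \<psi>) \<longleftrightarrow> sat M \<rho> \<phi> \<or> sat M \<rho> \<psi>"
| "sat M \<rho> (Imp \<phi> \<psi>) \<longleftrightarrow> (sat M \<rho> \<phi> \<longrightarrow> sat M \<rho> \<psi>)"
| "sat M \<rho> (Iff \<phi> \<psi>) \<longleftrightarrow> (sat M \<rho> \<phi> \<longleftrightarrow> sat M \<rho> \<psi>)"
| "sat M \<rho> (All x \<phi>) \<longleftrightarrow> (\<forall>a\<in>dom M. sat M (\<rho>(x := a)) \<phi>)"
| "sat M \<rho> (Ex x \<phi>) \<longleftrightarrow> (\<exists>a\<in>dom M. sat M (\<rho>(x := a)) \<phi>)"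

text \<open>The predicate \<open>N\<close> is a defined one: \<open>N_definition\<close> is its defining sentence, which
  every model has to satisfy whatever the scheme, so that the relation listed
  for \<open>N\<close> is the one defined from \<open>S\<close> and \<open>D\<close>.\<close>

definition N_definition :: fm where
  "N_definition =
     All ''z'' (Iff (PN ''z'')
       (Ex ''x'' (Ex ''y''
         (Conj (PS ''z'' ''x'' ''y'') (Conj (PD ''z'' ''x'') (PD ''z'' ''y''))))))"

definition holds_in :: "'a struct \<Rightarrow> fm \<Rightarrow> bool" where
  "holds_in M \<phi> \<longleftrightarrow> (\<forall>\<rho>. range \<rho> \<subseteq> dom M \<longrightarrow> sat M \<rho> \<phi>)"

definition is_model :: "'a struct \<Rightarrow> fm set \<Rightarrow> bool" where
  "is_model M \<Gamma> \<longleftrightarrow>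
     is_structure M \<and> holds_in M N_definition \<and> (\<forall>\<phi>\<in>\<Gamma>. holds_in M \<phi>)"

definition E1 :: fm where
  "E1 = Ex ''x'' (PT ''x'')"

definition E2 :: fm where
  "E2 = All ''x'' (Imp (PT ''x'') (Ex1 ''w'' ''y'' (PA ''y'' ''x'')))"

definition E3 :: fm where
  "E3 = All ''x'' (All ''y''
     (Imp (PA ''y'' ''x'') (Ex1 ''w'' ''z'' (PS ''z'' ''x'' ''y''))))"

definition E4 :: fm where
  "E4 = Ex ''x'' (PN ''x'')"

definition E5 :: fm where
  "E5 = All ''x'' (Imp (PN ''x'')
     (Ex ''y'' (Conj (PN ''y'') (Neg (Eq ''y'' ''x'')))))"

definition R1 :: fm where
  "R1 = All ''x'' (All ''y''
     (Imp (PA ''y'' ''x'') (Conj (PT ''x'') (Neg (PA ''x'' ''y'')))))"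

definition R2 :: fm where
  "R2 = All ''x'' (All ''y'' (All ''z''
     (Imp (PS ''z'' ''x'' ''y'')
       (Conj (PT ''z'')
         (Conj (Disj (PA ''x'' ''y'') (PA ''y'' ''x''))
               (Neg (Disj (PS ''x'' ''z'' ''y'') (PS ''y'' ''x'' ''z''))))))))"

definition TAS1 :: "fm set" where
  "TAS1 = {E1, E2, E3, R1, R2}"

definition TAS2 :: "fm set" where
  "TAS2 = {E1, E2, E3, R1, R2, E4, E5}"

definition theses_D :: "nat \<Rightarrow> nat set" where
  "theses_D k = {i. 0 \<le> i \<and> i \<le> k}"

definition antitheses_D :: "nat \<Rightarrow> nat set" where
  "antitheses_D k = {k + 1}"

text \<open>In \<open>S_rel\<close> the range \<open>0 \<le> i \<le> k - 1\<close> is written \<open>i < k\<close>, which avoids truncated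
  subtraction.\<close>

definition struct_D :: "nat \<Rightarrow> nat struct" where
  "struct_D k =
     \<lparr> dom = theses_D k \<union> antitheses_D k,
       T_rel = theses_D k,
       A_rel = {(k + 1, i) | i. 0 \<le> i \<and> i \<le> k},
       S_rel = {(i + 1, i, k + 1) | i. 0 \<le> i \<and> i < k} \<union> {(0, k, k + 1)},
       D_rel = {(1, 0), (1, k + 1), (2, 1), (2, k + 1)},
       N_rel = {1, 2} \<rparr>"

end

theory Submission
  imports Defs
begin

text \<open>Once y = k + 1, membership in \<open>S_rel\<close> says that z is the successor of x
  modulo k + 1. This functional form merges the wrap-around triple with the others and makes z
  unique.\<close>

lemma struct_D_simps [simp]:
  "dom (struct_D k) = {..k + 1}"
  "T_rel (struct_D k) = {..k}"
  "(y, x) \<in> A_rel (struct_D k) \<longleftrightarrow> y = k + 1 \<and> x \<le> k"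
  "(z, x, y) \<in> S_rel (struct_D k) \<longleftrightarrow>
     y = k + 1 \<and> x \<le> k \<and> z = (if x < k then x + 1 else 0)"
  "D_rel (struct_D k) = {(1, 0), (1, k + 1), (2, 1), (2, k + 1)}"
  "N_rel (struct_D k) = {1, 2}"
  by (auto simp: struct_D_def theses_D_def antitheses_D_def)

lemma is_structure_struct_D:
  assumes "k \<ge> 2"
  shows "is_structure (struct_D k)"
  using assms
  by (auto simp: is_structure_def split: if_splits)

lemma holds_N_definition:
  assumes "k \<ge> 2"
  shows "holds_in (struct_D k) N_definition"
proof -
  have "z \<in> {1, 2} \<longleftrightarrow>
      (\<exists>x\<le>k + 1. \<exists>y\<le>k + 1. (z, x, y) \<in> S_rel (struct_D k) \<and>
         (z, x) \<in> D_rel (struct_D k) \<and> (z, y) \<in> D_rel (struct_D k))" for z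
  proof
    assume "z \<in> {1, 2}"
    then show "\<exists>x\<le>k + 1. \<exists>y\<le>k + 1. (z, x, y) \<in> S_rel (struct_D k) \<and>
         (z, x) \<in> D_rel (struct_D k) \<and> (z, y) \<in> D_rel (struct_D k)"
      \<comment> \<open>\<open>D_rel\<close> pairs each z in {1, 2} with exactly z - 1 and k + 1.
        Since z - 1 < k by k \<ge> 2, z is the ordinary successor of z - 1, without
        wrap-around.\<close>
      using assms by (intro exI[of _ "z - 1"] exI[of _ "k + 1"] conjI) auto
  qed auto
  then show ?thesis
    by (simp add: holds_in_def N_definition_def Bex_def del: struct_D_simps(4,5))
qed

lemma holds_E1: "holds_in (struct_D k) E1"
  by (auto simp: holds_in_def E1_def)

lemma holds_E2: "holds_in (struct_D k) E2"
  by (auto simp: holds_in_def E2_def Ex1_def)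

lemma holds_E3: "holds_in (struct_D k) E3"
proof -
  have "\<exists>w\<le>k + 1. \<forall>z\<le>k + 1. (z, x, y) \<in> S_rel (struct_D k) \<longleftrightarrow> z = w"
    if "(y, x) \<in> A_rel (struct_D k)" for x y
    \<comment> \<open>The antithesis is y = k + 1 and x \<le> k, so the cyclic successor of x is the
      only candidate.\<close>
    using that by (intro exI[of _ "if x < k then x + 1 else 0"]) auto
  then show ?thesis
    by (simp add: holds_in_def E3_def Ex1_def Bex_def Ball_def del: struct_D_simps(3,4))
qed

text \<open>Pairs in \<open>A_rel\<close> start with k + 1 and end at most at k, so none can be
  reversed.\<close>

lemma holds_R1: "holds_in (struct_D k) R1"
  by (auto simp: holds_in_def R1_def)

text \<open>The bound on \<open>k\<close> is what makes \<open>R2\<close> hold: for \<open>k = 1\<close> the successor cycle has length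
  two, so \<open>S(1,0,2)\<close> and \<open>S(0,1,2)\<close> would both hold.\<close>

lemma holds_R2:
  assumes "k \<ge> 2"
  shows "holds_in (struct_D k) R2"
  using assms by (auto simp: holds_in_def R2_def)

lemma holds_E4: "holds_in (struct_D k) E4"
  by (auto simp: holds_in_def E4_def intro: bexI[of _ 1])

lemma holds_E5:
  assumes "k \<ge> 2"
  shows "holds_in (struct_D k) E5"
proof -
  have "\<exists>y\<le>k + 1. y \<in> {1, 2} \<and> y \<noteq> x" for x :: nat
    \<comment> \<open>1 and 2 are distinct, so one of them differs from x, whatever x is.\<close>
    using assms by (intro exI[of _ "if x = 1 then 2 else 1"]) auto
  then show ?thesis
    by (simp add: holds_in_def E5_def Bex_def)
qed

theorem theorem2p10:
  fixes k :: nat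
  assumes "k \<ge> 2"
  shows "is_model (struct_D k) TAS1 \<and> is_model (struct_D k) TAS2"
  using is_structure_struct_D[OF assms] holds_N_definition[OF assms]
    holds_E1 holds_E2 holds_E3 holds_R1 holds_R2[OF assms] holds_E4 holds_E5[OF assms]
  by (simp add: is_model_def TAS1_def TAS2_def)

end
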